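(* Let $m \geq 3$ be a fixed integer. Then for all sufficiently large positive integers $k$ (i.e., for all $k \ge k_0$, where $k_0$ may depend on $m$), \[ w(k,m) > k^{\,m-1-\frac{1}{\log \log k}} . \]
   Context: For positive integers $k$ and $m$, $w(k,m)$ denotes the least positive integer $n$ such that every 2-coloring of $[1,n]=\{1,2,\dots,n\}$ admits either a $k$-term arithmetic progression all of whose elements have the first color, or an $m$-term arithmetic progression all of whose elements have the second color. Such an $n$ exists by van der Waerden's theorem. Here $\log$ is the natural logarithm. *)

theory Defs
  imports Complex_Main
begin

definition arith_prog :: "nat \<Rightarrow> nat set \<Rightarrow> bool" where
  "arith_prog l A \<longleftrightarrow> (\<exists>a d. d > 0 \<and> A = (\<lambda>i. a + i * d) ` {..<l})"

text \<open>
  A 2-coloring of \<open>{1..n}\<close> is given by a function \<open>c\<close> into \<open>bool\<close>, the first color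
  being \<open>True\<close> and the second \<open>False\<close>; the values of \<open>c\<close> outside \<open>{1..n}\<close> play no role.
\<close>

definition vdw_property :: "nat \<Rightarrow> nat \<Rightarrow> nat \<Rightarrow> bool" where
  "vdw_property k m n \<longleftrightarrow>
    (\<forall>c :: nat \<Rightarrow> bool.
      (\<exists>A. arith_prog k A \<and> A \<subseteq> {1..n} \<and> (\<forall>x\<in>A. c x)) \<or>
      (\<exists>A. arith_prog m A \<and> A \<subseteq> {1..n} \<and> (\<forall>x\<in>A. \<not> c x)))"

text \<open>
  By van der Waerden's theorem the set of such \<open>n\<close> is nonempty for positive \<open>k\<close> and \<open>m\<close>;
  the operator \<open>LEAST\<close> is only meaningful because of this.
\<close>

definition vdw_number :: "nat \<Rightarrow> nat \<Rightarrow> nat" where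
  "vdw_number k m = (LEAST n. n > 0 \<and> vdw_property k m n)"

end

theory Submission
  imports Defs "HOL-Real_Asymp.Real_Asymp" "HOL-Library.Countable"
begin

text \<open>
  Rosenfeld's counting argument replaces the Lovasz local lemma. Each integer receives the second
  color with probability \<open>p = 2 (m + 2) ln k / k\<close>, and the total weight of the good colorings of a
  set shrinks by at most a factor \<open>\<beta> = 1 - p / 4\<close> whenever a point is added: a bad extension is
  monochromatic on some progression through the new point and good off it, so by induction the bad
  extensions weigh at most \<open>m n p^m / \<beta>^(m - 1) + k n (1 - p)^k / \<beta>^(k - 1)\<close> times the
  old total. For \<open>n\<close> up to the claimed bound this factor is at most \<open>p / 4\<close>.
  Since \<open>vdw_number\<close> is a \<open>LEAST\<close>, van der Waerden's theorem itself is needed too; it is proved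
  by color focusing.
\<close>

section \<open>Van der Waerden's theorem by color focusing\<close>

text \<open>
  The bound is on the term after the last one, so that it also covers the focus of a progression.
\<close>

definition has_mono_ap :: "nat \<Rightarrow> nat \<Rightarrow> (nat \<Rightarrow> nat) \<Rightarrow> bool" where
  "has_mono_ap l N c \<longleftrightarrow> (\<exists>a d. d > 0 \<and> a + l * d \<le> N \<and> (\<forall>i<l. c (a + i * d) = c a))"

text \<open>The color of the focus \<open>f\<close> is left free: either it agrees with one of the
  \<open>s\<close> colors and lengthens that progression, or it supplies a further color.\<close>

definition has_focused_aps :: "nat \<Rightarrow> nat \<Rightarrow> nat \<Rightarrow> (nat \<Rightarrow> nat) \<Rightarrow> bool" where
  "has_focused_aps s l N c \<longleftrightarrow> (\<exists>f a d. f \<le> N \<and> inj_on (\<lambda>j. c (a j)) {..<s} \<and>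
     (\<forall>j<s. d j > 0 \<and> a j + l * d j = f \<and> (\<forall>i<l. c (a j + i * d j) = c (a j))))"

text \<open>Cut the integers into blocks and treat the coloring of a whole block as one color. By
  \<open>vdw\<close> some \<open>l\<close> blocks in progression are colored identically. Focused
  progressions inside the first of them can be stretched across the blocks, and the copies of their
  focus form one more progression. Since blocks serve as colors, \<open>vdw\<close> is assumed for
  every finite set of colors and not just for \<open>K\<close>.\<close>

lemma has_mono_ap_or_focused_aps:
  fixes K :: "nat set"
  assumes vdw: "\<And>K'. finite K' \<Longrightarrow> \<exists>N. \<forall>c. range c \<subseteq> K' \<longrightarrow> has_mono_ap l N c"
    and l: "l > 0" and K: "finite K"
  shows "\<exists>N. \<forall>c. range c \<subseteq> K \<longrightarrow> has_mono_ap (Suc l) N c \<or> has_focused_aps s l N c"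
proof (induction s)
  case 0
  show ?case by (auto simp: has_focused_aps_def)
next
  case (Suc s)
  then obtain N where N: "\<And>c. range c \<subseteq> K \<Longrightarrow> has_mono_ap (Suc l) N c \<or> has_focused_aps s l N c"
    by blast
  \<comment> \<open>A block has the positions 0 to \<open>N\<close>, so it contains every focus that
    the induction hypothesis provides.\<close>
  define M where "M = Suc N"
  \<comment> \<open>Colors are natural numbers, so the list of colors in a block is encoded by
    \<open>to_nat\<close>.\<close>
  define K' where "K' = to_nat ` {xs. set xs \<subseteq> K \<and> length xs = M}"
  have "finite K'" unfolding K'_def using K by (simp add: finite_lists_length_eq)
  then obtain N' where N': "\<And>c. range c \<subseteq> K' \<Longrightarrow> has_mono_ap l N' c" using vdw by blast
  show ?case
  \<comment> \<open>\<open>N' * M\<close> bounds the start of the block after the last one in the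
    progression. Of \<open>2 * N\<close>, one \<open>N\<close> covers the position in a block, the
    other the extra step when a progression is extended through its focus.\<close>
  proof (intro exI[of _ "N' * M + 2 * N"] allI impI)
    fix c :: "nat \<Rightarrow> nat" assume c: "range c \<subseteq> K"
    define C where "C b = to_nat (map (\<lambda>x. c (b * M + x)) [0..<M])" for b
    have "range C \<subseteq> K'" using c by (fastforce simp: C_def K'_def)
    then obtain A D where D: "D > 0" and AD: "A + l * D \<le> N'"
      and CA: "\<And>i. i < l \<Longrightarrow> C (A + i * D) = C A"
      using N'[of C] unfolding has_mono_ap_def by blast
    have block: "c ((A + i * D) * M + x) = c (A * M + x)" if "i < l" "x \<le> N" for i x
    proof -
      have "map (\<lambda>x. c ((A + i * D) * M + x)) [0..<M] = map (\<lambda>x. c (A * M + x)) [0..<M]"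
        using CA[OF that(1)] unfolding C_def by (simp only: to_nat_split inj_eq[OF inj_to_nat])
      then have "\<forall>x\<in>{0..<M}. c ((A + i * D) * M + x) = c (A * M + x)"
        by (simp only: map_eq_conv set_upt)
      then show ?thesis using that(2) by (simp add: M_def)
    qed
    define c' where "c' x = c (A * M + x)" for x
    have c': "range c' \<subseteq> K" using c by (auto simp: c'_def)
    have AM: "A * M + l * (D * M) \<le> N' * M"
      using mult_le_mono1[OF AD, of M] by (simp add: algebra_simps)
    show "has_mono_ap (Suc l) (N' * M + 2 * N) c \<or> has_focused_aps (Suc s) l (N' * M + 2 * N) c"
      (is "?ap \<or> ?focus")
    proof -
      have shift: ?ap if "d > 0" "a + Suc l * d \<le> 2 * N"
          "\<And>i. i < Suc l \<Longrightarrow> c' (a + i * d) = c' a" for a d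
        unfolding has_mono_ap_def using that AM
        by (intro exI[of _ "A * M + a"] exI[of _ d]) (auto simp: c'_def add.assoc)
      from N[OF c'] consider
        (ap) a d where "d > 0" "a + Suc l * d \<le> N" "\<And>i. i < Suc l \<Longrightarrow> c' (a + i * d) = c' a"
      | (focus) f a d where "f \<le> N" "inj_on (\<lambda>j. c' (a j)) {..<s}"
          "\<And>j. j < s \<Longrightarrow> d j > 0" "\<And>j. j < s \<Longrightarrow> a j + l * d j = f"
          "\<And>j i. j < s \<Longrightarrow> i < l \<Longrightarrow> c' (a j + i * d j) = c' (a j)"
        unfolding has_mono_ap_def has_focused_aps_def by blast
      then show ?thesis
      proof cases
        case ap
        then show ?thesis using shift[of d a] by auto
      next
        case focus
        show ?thesis
        \<comment> \<open>If the focus has the color of progression \<open>j\<close>, appending it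
          gives \<open>l + 1\<close> terms. Otherwise its color is new.\<close>
        proof (cases "\<exists>j<s. c' (a j) = c' f")
          case True
          then obtain j where j: "j < s" "c' (a j) = c' f" by blast
          have "1 * d j \<le> l * d j" using l by (intro mult_le_mono1) simp
          then have "a j + Suc l * d j \<le> 2 * N"
            using focus(4)[OF j(1)] focus(1) unfolding mult_Suc by linarith
          moreover have "c' (a j + i * d j) = c' (a j)" if "i < Suc l" for i
            using that focus(4,5)[OF j(1)] j(2) by (cases "i = l") auto
          ultimately show ?thesis using shift[of "d j" "a j"] focus(3)[OF j(1)] by blast
        next
          case False
          \<comment> \<open>Old progressions gain \<open>D * M\<close> in their difference, moving
            one block further at each term. Index \<open>s\<close> is the new progression, which
            visits the position \<open>f\<close> in each block. All meet at position
            \<open>f\<close> of the next block.\<close>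
          define a' where "a' j = A * M + (if j < s then a j else f)" for j
          define d' where "d' j = (if j < s then d j else 0) + D * M" for j
          have ca': "c (a' j) = (if j < s then c' (a j) else c' f)" for j
            by (simp add: a'_def c'_def)
          have "inj_on (\<lambda>j. c (a' j)) {..<Suc s}"
            using focus(2) False unfolding ca' inj_on_def by (auto simp: less_Suc_eq)
          moreover have "A * M + f + l * (D * M) \<le> N' * M + 2 * N"
            using AM focus(1) by linarith
          moreover have "d' j > 0" for j using D by (simp add: d'_def M_def)
          moreover have "a' j + l * d' j = A * M + f + l * (D * M)" for j
            using focus(4)[of j] by (auto simp: a'_def d'_def algebra_simps)
          moreover have "c (a' j + i * d' j) = c (a' j)" if "i < l" for i j
          proof (cases "j < s")
            case True
            have "i * d j \<le> l * d j" using that by (intro mult_le_mono1) simp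
            then have "a j + i * d j \<le> N" using focus(1) focus(4)[OF True] by linarith
            moreover have "a' j + i * d' j = (A + i * D) * M + (a j + i * d j)"
              using True by (simp add: a'_def d'_def algebra_simps)
            ultimately show ?thesis
              using block[OF that, of "a j + i * d j"] focus(5)[OF True that] True
              by (simp add: ca' c'_def)
          next
            case False
            then have "a' j + i * d' j = (A + i * D) * M + f"
              by (simp add: a'_def d'_def algebra_simps)
            then show ?thesis using block[OF that focus(1)] False by (simp add: ca' c'_def)
          qed
          ultimately show ?thesis unfolding has_focused_aps_def by meson
        qed
      qed
    qed
  qed
qed

text \<open>Ask for one more focused progression than there are colors: their colors would be
  distinct, which the pigeonhole principle forbids, so the longer monochromatic progression must
  occur.\<close>

lemma van_der_waerden:
  "finite K \<Longrightarrow> \<exists>N. \<forall>c. range c \<subseteq> K \<longrightarrow> has_mono_ap (Suc l) N c"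
proof (induction l arbitrary: K)
  case 0
  show ?case unfolding has_mono_ap_def
    by (intro exI[of _ 1] allI impI exI[of _ 0] exI[of _ 1]) auto
next
  case (Suc l)
  from has_mono_ap_or_focused_aps[where s = "Suc (card K)", OF Suc.IH _ Suc.prems]
  obtain N where N: "\<And>c. range c \<subseteq> K \<Longrightarrow>
      has_mono_ap (Suc (Suc l)) N c \<or> has_focused_aps (Suc (card K)) (Suc l) N c"
    by auto
  have "\<not> has_focused_aps (Suc (card K)) (Suc l) N c" if "range c \<subseteq> K" for c
  proof
    assume "has_focused_aps (Suc (card K)) (Suc l) N c"
    then obtain a where "inj_on (\<lambda>j. c (a j)) {..<Suc (card K)}"
      unfolding has_focused_aps_def by blast
    then have "card {..<Suc (card K)} \<le> card K"
      by (rule card_inj_on_le) (use that Suc.prems in auto)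
    then show False by simp
  qed
  then show ?case using N by blast
qed

lemma vdw_property_exists: "\<exists>n>0. vdw_property k m n"
proof -
  \<comment> \<open>Whichever color the long progression has, it contains initial segments of both
    lengths \<open>k\<close> and \<open>m\<close>.\<close>
  define l where "l = k + m"
  obtain N where N: "\<And>c. range c \<subseteq> {0, 1} \<Longrightarrow> has_mono_ap (Suc l) N c"
    using van_der_waerden[of "{0, 1}" l] by auto
  have "vdw_property k m (Suc N)"
    unfolding vdw_property_def
  proof
    fix c :: "nat \<Rightarrow> bool"
    \<comment> \<open>The shift by one is needed because \<open>has_mono_ap\<close> starts at 0 and
      \<open>vdw_property\<close> at 1.\<close>
    define c' where "c' x = (if c (Suc x) then 1 else 0 :: nat)" for x
    have "range c' \<subseteq> {0, 1}" by (auto simp: c'_def)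
    then obtain a d where d: "d > 0" and bd: "a + Suc l * d \<le> N"
      and eq: "\<And>i. i < Suc l \<Longrightarrow> c' (a + i * d) = c' a"
      using N[of c'] unfolding has_mono_ap_def by blast
    have *: "arith_prog j ((\<lambda>i. Suc a + i * d) ` {..<j}) \<and> (\<lambda>i. Suc a + i * d) ` {..<j} \<subseteq> {1..Suc N}
        \<and> (\<forall>x\<in>(\<lambda>i. Suc a + i * d) ` {..<j}. c x = c (Suc a))" if "j \<le> l" for j
    proof -
      have "a + i * d \<le> N" if "i < j" for i
        using bd mult_le_mono1[of i "Suc l" d] that \<open>j \<le> l\<close> by linarith
      moreover have "c (Suc a + i * d) = c (Suc a)" if "i < j" for i
        using eq[of i] that \<open>j \<le> l\<close> by (auto simp: c'_def split: if_splits)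
      moreover have "arith_prog j ((\<lambda>i. Suc a + i * d) ` {..<j})"
        using d unfolding arith_prog_def by blast
      ultimately show ?thesis by auto
    qed
    show "(\<exists>A. arith_prog k A \<and> A \<subseteq> {1..Suc N} \<and> (\<forall>x\<in>A. c x)) \<or>
      (\<exists>A. arith_prog m A \<and> A \<subseteq> {1..Suc N} \<and> (\<forall>x\<in>A. \<not> c x))"
    proof (cases "c (Suc a)")
      case True
      then show ?thesis using *[of k] unfolding l_def by (metis le_add1)
    next
      case False
      then show ?thesis using *[of m] unfolding l_def by (metis le_add2)
    qed
  qed
  then show ?thesis by blast
qed

section \<open>Weighted counting of avoiding sets\<close>

text \<open>
  A set \<open>R\<close> encodes the coloring whose second color class is \<open>R\<close>; a pair \<open>(A, B)\<close> in \<open>E\<close> forbids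
  that \<open>A\<close> lies inside \<open>R\<close> while \<open>B\<close> lies outside.
\<close>

definition avoiding :: "('a set \<times> 'a set) set \<Rightarrow> 'a set \<Rightarrow> 'a set set" where
  "avoiding E V = {R. R \<subseteq> V \<and> (\<forall>(A, B)\<in>E. A \<union> B \<subseteq> V \<longrightarrow> A \<subseteq> R \<longrightarrow> B \<inter> R \<noteq> {})}"

text \<open>For \<open>R\<close> inside a finite \<open>V\<close> and \<open>p\<close> in [0, 1],
  this is the probability of drawing \<open>R\<close> when each point of \<open>V\<close> is chosen
  independently with probability \<open>p\<close>.\<close>

definition weight :: "real \<Rightarrow> 'a set \<Rightarrow> 'a set \<Rightarrow> real" where
  "weight p V R = p ^ card R * (1 - p) ^ card (V - R)"

definition avoid_weight :: "real \<Rightarrow> ('a set \<times> 'a set) set \<Rightarrow> 'a set \<Rightarrow> real" where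
  "avoid_weight p E V = sum (weight p V) (avoiding E V)"

lemma finite_avoiding: "finite V \<Longrightarrow> finite (avoiding E V)"
  by (rule finite_subset[of _ "Pow V"]) (auto simp: avoiding_def)

lemma weight_nonneg: "0 \<le> p \<Longrightarrow> p \<le> 1 \<Longrightarrow> 0 \<le> weight p V R"
  by (simp add: weight_def)

lemma avoid_weight_nonneg: "0 \<le> p \<Longrightarrow> p \<le> 1 \<Longrightarrow> 0 \<le> avoid_weight p E V"
  unfolding avoid_weight_def by (intro sum_nonneg weight_nonneg)

lemma sum_UN_le:
  fixes f :: "'b \<Rightarrow> real"
  assumes "finite I" "\<And>i. i \<in> I \<Longrightarrow> finite (T i)" "\<And>x. 0 \<le> f x"
  shows "sum f (\<Union>i\<in>I. T i) \<le> (\<Sum>i\<in>I. sum f (T i))"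
  using assms
proof (induction I rule: finite_induct)
  case (insert i I)
  have "sum f (T i \<union> (\<Union>i\<in>I. T i)) \<le> sum f (T i) + sum f (\<Union>i\<in>I. T i)"
    using insert by (subst sum.union_inter[symmetric]) (auto intro!: sum_nonneg)
  with insert show ?case by fastforce
qed simp

text \<open>This is independence: the choices on \<open>A\<close> and \<open>B\<close> are forced
  and contribute one factor per point, while the rest of \<open>R\<close> ranges freely over the
  given family.\<close>

lemma sum_weight_cylinder:
  assumes "finite U" "A \<union> B \<subseteq> U" "A \<inter> B = {}"
    and \<R>: "\<And>R. R \<in> \<R> \<Longrightarrow> R \<subseteq> U - (A \<union> B)"
  shows "(\<Sum>R | R \<subseteq> U \<and> A \<subseteq> R \<and> B \<inter> R = {} \<and> R - (A \<union> B) \<in> \<R>. weight p U R)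
    = p ^ card A * (1 - p) ^ card B * sum (weight p (U - (A \<union> B))) \<R>"
proof -
  have "(\<Sum>R | R \<subseteq> U \<and> A \<subseteq> R \<and> B \<inter> R = {} \<and> R - (A \<union> B) \<in> \<R>. weight p U R)
    = (\<Sum>R\<in>\<R>. weight p U (A \<union> R))"
  proof (rule sum.reindex_bij_witness[of _ "\<lambda>R. A \<union> R" "\<lambda>R. R - (A \<union> B)"])
    fix R assume "R \<in> {R. R \<subseteq> U \<and> A \<subseteq> R \<and> B \<inter> R = {} \<and> R - (A \<union> B) \<in> \<R>}"
    then show "A \<union> (R - (A \<union> B)) = R" "R - (A \<union> B) \<in> \<R>"
      "weight p U (A \<union> (R - (A \<union> B))) = weight p U R"
      by (auto intro!: arg_cong[of _ _ "weight p U"])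
  next
    fix R assume R: "R \<in> \<R>"
    show *: "A \<union> R - (A \<union> B) = R" using \<R>[OF R] by auto
    show "A \<union> R \<in> {R. R \<subseteq> U \<and> A \<subseteq> R \<and> B \<inter> R = {} \<and> R - (A \<union> B) \<in> \<R>}"
      using \<R>[OF R] R assms * by auto
  qed
  also have "\<dots> = (\<Sum>R\<in>\<R>. p ^ card A * (1 - p) ^ card B * weight p (U - (A \<union> B)) R)"
  proof (rule sum.cong[OF refl])
    fix R assume "R \<in> \<R>"
    note R = \<R>[OF this]
    have fin: "finite A" "finite B" "finite R" "finite (U - (A \<union> B) - R)"
      using assms(1,2) R by (auto intro: finite_subset)
    have "card (A \<union> R) = card A + card R"
      using R fin by (intro card_Un_disjoint) auto
    moreover have "U - (A \<union> R) = B \<union> (U - (A \<union> B) - R)" using assms(2,3) R by auto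
    moreover have "card (B \<union> (U - (A \<union> B) - R)) = card B + card (U - (A \<union> B) - R)"
      using fin by (intro card_Un_disjoint) auto
    ultimately show "weight p U (A \<union> R) = p ^ card A * (1 - p) ^ card B * weight p (U - (A \<union> B)) R"
      by (simp add: weight_def power_add)
  qed
  finally show ?thesis by (simp add: sum_distrib_left)
qed

text \<open>Extend the avoiding subsets of \<open>V\<close> to \<open>v\<close> in both ways, which
  preserves their total weight. An extension that fails violates a pair through \<open>v\<close>,
  and off that pair it is still avoiding. A union bound over these pairs gives the sum.\<close>

lemma avoid_weight_insert:
  assumes p: "0 \<le> p" "p \<le> 1" and V: "finite V" "v \<notin> V" and E: "finite E"
    and disj: "\<And>A B. (A, B) \<in> E \<Longrightarrow> A \<inter> B = {}"
  shows "avoid_weight p E V \<le> avoid_weight p E (insert v V) +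
    (\<Sum>(A, B) | (A, B) \<in> E \<and> v \<in> A \<union> B \<and> A \<union> B \<subseteq> insert v V.
       p ^ card A * (1 - p) ^ card B * avoid_weight p E (insert v V - (A \<union> B)))"
proof -
  define U where "U = insert v V"
  define E' where "E' = {(A, B). (A, B) \<in> E \<and> v \<in> A \<union> B \<and> A \<union> B \<subseteq> U}"
  define T where "T A B = {R. R \<subseteq> U \<and> A \<subseteq> R \<and> B \<inter> R = {} \<and>
    R - (A \<union> B) \<in> avoiding E (U - (A \<union> B))}" for A B
  \<comment> \<open>\<open>S1\<close> and \<open>S2\<close> are the extensions with \<open>v\<close>
    inside and outside \<open>R\<close>; they carry the fractions \<open>p\<close> and
    \<open>1 - p\<close> of the old weight.\<close>
  define S1 where "S1 = {R. R \<subseteq> U \<and> {v} \<subseteq> R \<and> {} \<inter> R = {} \<and> R - ({v} \<union> {}) \<in> avoiding E V}"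
  define S2 where "S2 = {R. R \<subseteq> U \<and> {} \<subseteq> R \<and> {v} \<inter> R = {} \<and> R - ({} \<union> {v}) \<in> avoiding E V}"
  have finU: "finite U" using V by (simp add: U_def)
  have UV: "U - {v} = V" using V by (auto simp: U_def)
  have sub: "\<And>R. R \<in> avoiding E W \<Longrightarrow> R \<subseteq> W" for W by (auto simp: avoiding_def)
  have finE': "finite E'" by (rule finite_subset[OF _ E]) (auto simp: E'_def)
  have fin: "finite S1" "finite S2" "\<And>A B. finite (T A B)"
    by (rule finite_subset[of _ "Pow U"], force simp: S1_def S2_def T_def, simp add: finU)+
  have "sum (weight p U) S1 = p * avoid_weight p E V"
    unfolding S1_def avoid_weight_def
    by (subst sum_weight_cylinder) (use finU UV sub in \<open>auto simp: U_def\<close>)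
  moreover have "sum (weight p U) S2 = (1 - p) * avoid_weight p E V"
    unfolding S2_def avoid_weight_def
    by (subst sum_weight_cylinder) (use finU UV sub in \<open>auto simp: U_def\<close>)
  ultimately have "avoid_weight p E V = sum (weight p U) S1 + sum (weight p U) S2"
    by (simp add: algebra_simps)
  also have "\<dots> = sum (weight p U) (S1 \<union> S2)"
    by (rule sum.union_disjoint[symmetric]) (use fin in \<open>auto simp: S1_def S2_def\<close>)
  also have "\<dots> \<le> sum (weight p U) (avoiding E U \<union> (\<Union>(A, B)\<in>E'. T A B))"
  proof (rule sum_mono2)
    show "finite (avoiding E U \<union> (\<Union>(A, B)\<in>E'. T A B))"
      using finite_avoiding[OF finU] finE' fin by auto
    show "S1 \<union> S2 \<subseteq> avoiding E U \<union> (\<Union>(A, B)\<in>E'. T A B)"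
    proof
      fix R assume "R \<in> S1 \<union> S2"
      then have R: "R \<subseteq> U" "R - {v} \<in> avoiding E V" by (auto simp: S1_def S2_def)
      show "R \<in> avoiding E U \<union> (\<Union>(A, B)\<in>E'. T A B)"
      proof (cases "R \<in> avoiding E U")
        case False
        then obtain A B where AB: "(A, B) \<in> E" "A \<union> B \<subseteq> U" "A \<subseteq> R" "B \<inter> R = {}"
          using R(1) by (auto simp: avoiding_def)
        have Vgood: "B' \<inter> (R - {v}) \<noteq> {}" if "(A', B') \<in> E" "A' \<union> B' \<subseteq> V" "A' \<subseteq> R - {v}" for A' B'
          using R(2) that unfolding avoiding_def by blast
        have v: "v \<in> A \<union> B"
        proof (rule ccontr)
          assume "v \<notin> A \<union> B"
          then have "A \<union> B \<subseteq> V" "A \<subseteq> R - {v}" using AB by (auto simp: U_def)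
          from Vgood[OF AB(1) this] AB(4) show False by auto
        qed
        \<comment> \<open>Since \<open>v\<close> lies in \<open>A \<union> B\<close>, only pairs
          inside \<open>V\<close> remain to be checked, and those are handled by
          \<open>R - {v}\<close>.\<close>
        have "R - (A \<union> B) \<in> avoiding E (U - (A \<union> B))"
          unfolding avoiding_def
        proof (safe, goal_cases)
          case (1 x) then show ?case using R(1) by auto
        next
          case (2 A' B')
          then have "A' \<union> B' \<subseteq> V" "A' \<subseteq> R - {v}" using v UV by auto
          from Vgood[OF 2(1) this] 2 show ?case by auto
        qed
        then have "R \<in> T A B" using AB R(1) by (auto simp: T_def)
        moreover have "(A, B) \<in> E'" using AB v by (simp add: E'_def)
        ultimately show ?thesis by blast
      qed simp
    qed
  qed (simp add: weight_nonneg p)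
  also have "\<dots> \<le> sum (weight p U) (avoiding E U) + sum (weight p U) (\<Union>(A, B)\<in>E'. T A B)"
    by (subst sum.union_inter[symmetric])
       (use finite_avoiding[OF finU] finE' fin in \<open>auto intro!: sum_nonneg weight_nonneg p\<close>)
  also have "sum (weight p U) (\<Union>(A, B)\<in>E'. T A B) \<le> (\<Sum>(A, B)\<in>E'. sum (weight p U) (T A B))"
    using sum_UN_le[of E' "\<lambda>(A, B). T A B" "weight p U"] finE' fin
    by (simp add: case_prod_unfold weight_nonneg p)
  also have "\<dots> = (\<Sum>(A, B)\<in>E'. p ^ card A * (1 - p) ^ card B * avoid_weight p E (U - (A \<union> B)))"
  proof (rule sum.cong[OF refl], clarify)
    fix A B assume "(A, B) \<in> E'"
    then have AB: "(A, B) \<in> E" "A \<union> B \<subseteq> U" by (auto simp: E'_def)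
    show "sum (weight p U) (T A B) = p ^ card A * (1 - p) ^ card B * avoid_weight p E (U - (A \<union> B))"
      unfolding T_def avoid_weight_def
      by (rule sum_weight_cylinder[OF finU AB(2) disj[OF AB(1)] sub])
  qed
  finally show ?thesis by (simp add: avoid_weight_def E'_def U_def)
qed

text \<open>Add the points of \<open>Y - W\<close> one by one, each costing a factor
  \<open>\<beta>\<close>. The step is assumed only inside \<open>Y\<close>, so that the lemma can be
  applied to a proper subset in the middle of an induction.\<close>

lemma avoid_weight_chain:
  fixes p \<beta> :: real
  assumes "finite Y" "0 \<le> \<beta>" "W \<subseteq> Y"
    and step: "\<And>V v. V \<subseteq> Y \<Longrightarrow> v \<in> V \<Longrightarrow> \<beta> * avoid_weight p E (V - {v}) \<le> avoid_weight p E V"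
  shows "\<beta> ^ card (Y - W) * avoid_weight p E W \<le> avoid_weight p E Y"
proof -
  have "\<beta> ^ card Z * avoid_weight p E W \<le> avoid_weight p E (W \<union> Z)" if "finite Z" "Z \<subseteq> Y - W" for Z
    using that
  proof (induction Z rule: finite_induct)
    case (insert z Z)
    have "\<beta> ^ card (insert z Z) * avoid_weight p E W = \<beta> * (\<beta> ^ card Z * avoid_weight p E W)"
      using insert by simp
    also have "\<dots> \<le> \<beta> * avoid_weight p E (W \<union> Z)"
      using insert assms(2) by (intro mult_left_mono) auto
    also have "W \<union> Z = (W \<union> insert z Z) - {z}" using insert by auto
    also have "\<beta> * avoid_weight p E \<dots> \<le> avoid_weight p E (W \<union> insert z Z)"
      using insert assms(3) by (intro step) auto
    finally show ?case .
  qed simp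
  from this[of "Y - W"] assms show ?thesis by (simp add: Un_absorb1)
qed

lemma avoiding_nonempty:
  fixes p \<beta> :: real
  assumes p: "0 \<le> p" "p \<le> 1" and \<beta>: "0 < \<beta>" and X: "finite X" and E: "finite E"
    and edges: "\<And>A B. (A, B) \<in> E \<Longrightarrow> A \<inter> B = {} \<and> A \<union> B \<noteq> {}"
    and local: "\<And>v. v \<in> X \<Longrightarrow> (\<Sum>(A, B) | (A, B) \<in> E \<and> v \<in> A \<union> B.
        p ^ card A * (1 - p) ^ card B / \<beta> ^ (card (A \<union> B) - 1)) \<le> 1 - \<beta>"
  shows "avoiding E X \<noteq> {}"
proof -
  have step: "\<beta> * avoid_weight p E (V - {v}) \<le> avoid_weight p E V" if "V \<subseteq> X" "v \<in> V" for V v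
  proof -
    have "finite V" using that X finite_subset by blast
    then show ?thesis using that
    proof (induction V arbitrary: v rule: finite_psubset_induct)
      case (psubset V)
      define W where "W = V - {v}"
      have V: "V = insert v W" "v \<notin> W" "finite W" using psubset by (auto simp: W_def)
      let ?g = "avoid_weight p E"
      have "?g W \<le> ?g V + (\<Sum>(A, B) | (A, B) \<in> E \<and> v \<in> A \<union> B \<and> A \<union> B \<subseteq> V.
          p ^ card A * (1 - p) ^ card B * ?g (V - (A \<union> B)))"
        using avoid_weight_insert[OF p V(3,2) E] edges unfolding V(1) by auto
      also have "(\<Sum>(A, B) | (A, B) \<in> E \<and> v \<in> A \<union> B \<and> A \<union> B \<subseteq> V.
          p ^ card A * (1 - p) ^ card B * ?g (V - (A \<union> B)))
        \<le> (\<Sum>(A, B) | (A, B) \<in> E \<and> v \<in> A \<union> B \<and> A \<union> B \<subseteq> V.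
          p ^ card A * (1 - p) ^ card B / \<beta> ^ (card (A \<union> B) - 1) * ?g W)"
      proof (rule sum_mono, clarify)
        fix A B assume AB: "(A, B) \<in> E" "v \<in> A \<union> B" "A \<union> B \<subseteq> V"
        \<comment> \<open>The induction hypothesis covers all subsets of \<open>W\<close>. As
          \<open>v\<close> is already absent from \<open>W\<close>, only
          \<open>card (A \<union> B) - 1\<close> points have to be put back.\<close>
        have "\<beta> ^ card (W - (V - (A \<union> B))) * ?g (V - (A \<union> B)) \<le> ?g W"
        proof (rule avoid_weight_chain[OF V(3)])
          show "V - (A \<union> B) \<subseteq> W" using AB(2) by (auto simp: W_def)
          fix V' v' assume "V' \<subseteq> W" "v' \<in> V'"
          then show "\<beta> * ?g (V' - {v'}) \<le> ?g V'"
            using V psubset.prems by (intro psubset.IH) auto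
        qed (use \<beta> in simp)
        also have "W - (V - (A \<union> B)) = A \<union> B - {v}" using AB V by auto
        also have "card (A \<union> B - {v}) = card (A \<union> B) - 1" using AB by (simp add: card_Diff_singleton)
        finally have "?g (V - (A \<union> B)) \<le> ?g W / \<beta> ^ (card (A \<union> B) - 1)"
          using \<beta> by (simp add: field_simps)
        then have "p ^ card A * (1 - p) ^ card B * ?g (V - (A \<union> B))
          \<le> p ^ card A * (1 - p) ^ card B * (?g W / \<beta> ^ (card (A \<union> B) - 1))"
          using p by (intro mult_left_mono) auto
        then show "p ^ card A * (1 - p) ^ card B * ?g (V - (A \<union> B))
          \<le> p ^ card A * (1 - p) ^ card B / \<beta> ^ (card (A \<union> B) - 1) * ?g W" by simp
      qed
      \<comment> \<open>The terms are nonnegative, so pairs that leave \<open>V\<close> may be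
        included to match the assumption \<open>local\<close>.\<close>
      also have "\<dots> \<le> (\<Sum>(A, B) | (A, B) \<in> E \<and> v \<in> A \<union> B.
          p ^ card A * (1 - p) ^ card B / \<beta> ^ (card (A \<union> B) - 1) * ?g W)"
      proof (rule sum_mono2)
        show "finite {(A, B). (A, B) \<in> E \<and> v \<in> A \<union> B}"
          by (rule finite_subset[OF _ E]) auto
        show "0 \<le> (case AB of (A, B) \<Rightarrow>
            p ^ card A * (1 - p) ^ card B / \<beta> ^ (card (A \<union> B) - 1) * ?g W)" for AB
          using p \<beta> avoid_weight_nonneg[OF p, of E W] by (simp split: prod.split)
      qed auto
      also have "\<dots> = (\<Sum>(A, B) | (A, B) \<in> E \<and> v \<in> A \<union> B.
          p ^ card A * (1 - p) ^ card B / \<beta> ^ (card (A \<union> B) - 1)) * ?g W"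
        by (simp add: sum_distrib_right case_prod_unfold)
      also have "\<dots> \<le> (1 - \<beta>) * ?g W"
        using local[of v] psubset.prems avoid_weight_nonneg[OF p] by (intro mult_right_mono) auto
      finally show ?case by (simp add: W_def algebra_simps)
    qed
  qed
  \<comment> \<open>No pair is empty on both sides, so nothing is forbidden on the empty set and the
    chain starts from weight 1.\<close>
  have "avoiding E {} = {{}}" using edges by (force simp: avoiding_def)
  then have "avoid_weight p E {} = 1" by (simp add: avoid_weight_def weight_def)
  then have "\<beta> ^ card X \<le> avoid_weight p E X"
    using avoid_weight_chain[of X \<beta> "{}" p E, OF X] step \<beta> by auto
  moreover have "\<beta> ^ card X > 0" using \<beta> by simp
  ultimately show ?thesis unfolding avoid_weight_def by fastforce
qed

section \<open>Progressions as forbidden pairs\<close>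

text \<open>A progression through \<open>v\<close> is determined by the index at which it meets
  \<open>v\<close> and by its difference, which is at most \<open>n\<close> because the second term
  is still in range.\<close>

lemma card_arith_progs_through:
  assumes "l \<ge> 2"
  shows "card {A. arith_prog l A \<and> A \<subseteq> {1..n} \<and> v \<in> A} \<le> l * n"
proof -
  have "{A. arith_prog l A \<and> A \<subseteq> {1..n} \<and> v \<in> A}
      \<subseteq> (\<lambda>(i, d). (\<lambda>j. v - i * d + j * d) ` {..<l}) ` ({..<l} \<times> {1..n})"
  proof
    fix A assume "A \<in> {A. arith_prog l A \<and> A \<subseteq> {1..n} \<and> v \<in> A}"
    then obtain a d where d: "d > 0" and A: "A = (\<lambda>i. a + i * d) ` {..<l}" "A \<subseteq> {1..n}" "v \<in> A"
      by (auto simp: arith_prog_def)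
    from A obtain i where i: "i < l" "v = a + i * d" by auto
    have "a + 1 * d \<in> A" unfolding A(1) using assms by (intro image_eqI[of _ _ 1]) auto
    then have "d \<le> n" using A(2) by auto
    then show "A \<in> (\<lambda>(i, d). (\<lambda>j. v - i * d + j * d) ` {..<l}) ` ({..<l} \<times> {1..n})"
      using i d A(1) by (intro image_eqI[of _ _ "(i, d)"]) auto
  qed
  then have "card {A. arith_prog l A \<and> A \<subseteq> {1..n} \<and> v \<in> A} \<le> card ({..<l} \<times> {1..n})"
    by (intro surj_card_le) auto
  then show ?thesis by (simp add: card_cartesian_product)
qed

lemma card_arith_prog: "arith_prog l A \<Longrightarrow> card A = l"
  by (auto simp: arith_prog_def card_image inj_on_def)

lemma not_vdw_propertyI:
  fixes p \<beta> :: real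
  assumes mk: "m \<ge> 2" "k \<ge> 2" and p: "0 \<le> p" "p \<le> 1" and \<beta>: "0 < \<beta>"
    and local: "real (m * n) * (p ^ m / \<beta> ^ (m - 1)) + real (k * n) * ((1 - p) ^ k / \<beta> ^ (k - 1)) \<le> 1 - \<beta>"
  shows "\<not> vdw_property k m n"
proof -
  define P where "P l = {A. arith_prog l A \<and> A \<subseteq> {1..n}}" for l
  define Q where "Q l v = {A. arith_prog l A \<and> A \<subseteq> {1..n} \<and> v \<in> A}" for l v
  \<comment> \<open>\<open>R\<close> will be the set colored \<open>False\<close>: no
    \<open>m\<close>-term progression may lie inside it and no \<open>k\<close>-term progression
    outside.\<close>
  define E where "E = (\<lambda>A. (A, {})) ` P m \<union> (\<lambda>B. ({}, B)) ` P k"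
  have finP: "finite (P l)" for l
    by (rule finite_subset[of _ "Pow {1..n}"]) (auto simp: P_def)
  have finQ: "finite (Q l v)" for l v
    by (rule finite_subset[OF _ finP[of l]]) (auto simp: P_def Q_def)
  have "avoiding E {1..n} \<noteq> {}"
  proof (rule avoiding_nonempty[OF p \<beta>])
    show "finite E" using finP by (simp add: E_def)
    show "A \<inter> B = {} \<and> A \<union> B \<noteq> {}" if "(A, B) \<in> E" for A B
      using that mk by (auto simp: E_def P_def dest!: card_arith_prog)
    fix v
    have "{(A, B). (A, B) \<in> E \<and> v \<in> A \<union> B} = (\<lambda>A. (A, {})) ` Q m v \<union> (\<lambda>B. ({}, B)) ` Q k v"
      by (auto simp: E_def P_def Q_def)
    moreover have "(\<Sum>(A, B)\<in>(\<lambda>A. (A, {})) ` Q m v \<union> (\<lambda>B. ({}, B)) ` Q k v.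
        p ^ card A * (1 - p) ^ card B / \<beta> ^ (card (A \<union> B) - 1))
      = (\<Sum>A\<in>Q m v. p ^ card A / \<beta> ^ (card A - 1)) + (\<Sum>B\<in>Q k v. (1 - p) ^ card B / \<beta> ^ (card B - 1))"
      by (subst sum.union_disjoint)
         (use finQ in \<open>auto simp: Q_def sum.reindex inj_on_def\<close>)
    moreover have "(\<Sum>A\<in>Q m v. p ^ card A / \<beta> ^ (card A - 1)) = (\<Sum>A\<in>Q m v. p ^ m / \<beta> ^ (m - 1))"
      by (rule sum.cong) (auto simp: Q_def dest!: card_arith_prog)
    moreover have "(\<Sum>B\<in>Q k v. (1 - p) ^ card B / \<beta> ^ (card B - 1)) = (\<Sum>B\<in>Q k v. (1 - p) ^ k / \<beta> ^ (k - 1))"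
      by (rule sum.cong) (auto simp: Q_def dest!: card_arith_prog)
    moreover have "real (card (Q m v)) * (p ^ m / \<beta> ^ (m - 1)) \<le> real (m * n) * (p ^ m / \<beta> ^ (m - 1))"
      using card_arith_progs_through[OF mk(1), of n v] p \<beta>
      unfolding Q_def by (intro mult_right_mono) (simp_all only: of_nat_le_iff, simp)
    moreover have "real (card (Q k v)) * ((1 - p) ^ k / \<beta> ^ (k - 1)) \<le> real (k * n) * ((1 - p) ^ k / \<beta> ^ (k - 1))"
      using card_arith_progs_through[OF mk(2), of n v] p \<beta>
      unfolding Q_def by (intro mult_right_mono) (simp_all only: of_nat_le_iff, simp)
    ultimately show "(\<Sum>(A, B) | (A, B) \<in> E \<and> v \<in> A \<union> B.
        p ^ card A * (1 - p) ^ card B / \<beta> ^ (card (A \<union> B) - 1)) \<le> 1 - \<beta>"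
      using local by simp
  qed simp
  then obtain R where R: "R \<in> avoiding E {1..n}" by blast
  have "\<not> A \<subseteq> R" if "A \<in> P m" for A
    using R that unfolding avoiding_def E_def P_def by blast
  moreover have "B \<inter> R \<noteq> {}" if "B \<in> P k" for B
    using R that unfolding avoiding_def E_def P_def by blast
  ultimately show ?thesis
    unfolding vdw_property_def P_def by (intro notI, drule_tac x = "\<lambda>x. x \<notin> R" in spec) blast
qed

section \<open>Choice of parameters and asymptotics\<close>

text \<open>The power of \<open>x\<close> is exp(- ln x / ln (ln x)), which beats every fixed power
  of \<open>ln x\<close> because ln x / ln (ln x) outgrows ln (ln x). This is what the loss in the
  exponent of the theorem pays for.\<close>

lemma eventually_mult_ln_powr_small:
  fixes C D M :: real
  assumes "C > 0" "D > 0" "M \<ge> 0"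
  shows "eventually (\<lambda>x. D * (x powr (- 1 / ln (ln x)) * (C * ln x) powr M) \<le> 1 / 8) at_top"
proof -
  have "((\<lambda>x. D * (x powr (- 1 / ln (ln x)) * (C * ln x) powr M)) \<longlongrightarrow> 0) at_top"
    using assms by real_asymp
  then have "eventually (\<lambda>x. D * (x powr (- 1 / ln (ln x)) * (C * ln x) powr M) < 1 / 8) at_top"
    by (rule order_tendstoD) simp
  then show ?thesis by eventually_elim simp
qed

lemma not_vdw_property_asymp:
  assumes m: "m \<ge> 2"
  shows "\<exists>k0. \<forall>k\<ge>k0. \<forall>n. real n \<le> real k powr (real m - 1 - 1 / ln (ln (real k))) \<longrightarrow>
    \<not> vdw_property k m n"
proof -
  \<comment> \<open>With \<open>p = C * ln k / k\<close>, the bound exp(- p k / 2) equals k^-(m +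
    2); multiplied by \<open>k * n\<close>, at most k^m, it leaves 1 / k^2.\<close>
  define C where "C = 2 * (real m + 2)"
  have C: "C > 0" by (simp add: C_def)
  \<comment> \<open>The factor 2 before \<open>C\<close> comes from
    \<open>\<beta> \<ge> 1 / 2\<close>, which gives \<open>p / \<beta> \<le> 2 * p\<close>.\<close>
  have "eventually (\<lambda>x. real m * (x powr (- 1 / ln (ln x)) * (2 * C * ln x) powr (real m - 1)) \<le> 1 / 8) at_top"
    using C m by (intro eventually_mult_ln_powr_small) auto
  moreover have "eventually (\<lambda>x. x > 1 \<and> ln (ln x) > 0 \<and> C * ln x / x < 1 / 2 \<and> 1 / x\<^sup>2 \<le> C * ln x / x / 8) at_top"
    using C by (intro eventually_conj; real_asymp)
  ultimately have "eventually (\<lambda>x. real m * (x powr (- 1 / ln (ln x)) * (2 * C * ln x) powr (real m - 1)) \<le> 1 / 8 \<and>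
      x > 1 \<and> ln (ln x) > 0 \<and> C * ln x / x < 1 / 2 \<and> 1 / x\<^sup>2 \<le> C * ln x / x / 8) at_top"
    by eventually_elim simp
  from eventually_compose_filterlim[OF this filterlim_real_sequentially]
  obtain k0 where k0: "\<And>k. k \<ge> k0 \<Longrightarrow> real m * (real k powr (- 1 / ln (ln (real k))) *
        (2 * C * ln (real k)) powr (real m - 1)) \<le> 1 / 8 \<and>
      real k > 1 \<and> ln (ln (real k)) > 0 \<and> C * ln (real k) / real k < 1 / 2 \<and>
      1 / (real k)\<^sup>2 \<le> C * ln (real k) / real k / 8"
    unfolding eventually_sequentially by blast
  have "\<not> vdw_property k m n"
    if k: "k \<ge> k0" and n: "real n \<le> real k powr (real m - 1 - 1 / ln (ln (real k)))" for k n
  proof -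
    define K where "K = real k"
    define p where "p = C * ln K / K"
    \<comment> \<open>The allowance \<open>1 - \<beta> = p / 4\<close> is split evenly,
      \<open>p / 8\<close> for each kind of progression.\<close>
    define \<beta> where "\<beta> = 1 - p / 4"
    note k0' = k0[OF k, folded K_def, folded p_def]
    have K: "K > 1" "ln (ln K) > 0" "ln K > 0" using k0' by auto
    have p: "0 < p" "p < 1 / 2" using k0' K C by (auto simp: p_def)
    have \<beta>: "1 / 2 \<le> \<beta>" "\<beta> \<le> 1" using p by (auto simp: \<beta>_def)
    obtain M where M: "m = Suc M" using m by (cases m) auto
    obtain j where j: "k = Suc j" using K by (cases k) (auto simp: K_def)
    have powM: "y powr (real m - 1) = y ^ M" if "y > 0" for y :: real
      using that by (simp add: M powr_realpow)
    have n': "real n \<le> K ^ M * K powr (- 1 / ln (ln K))"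
      using n K powM[of K] unfolding K_def[symmetric]
      by (simp add: powr_add[symmetric] algebra_simps flip: powM)
    \<comment> \<open>One factor \<open>p\<close> is set aside; the other \<open>m - 1\<close> pair
      with the powers of \<open>\<beta>\<close>, and their \<open>1 / K ^ M\<close> cancels the main
      term of \<open>n\<close>.\<close>
    have "real (m * n) * (p ^ m / \<beta> ^ (m - 1)) \<le> p / 8"
    proof -
      have "(p / \<beta>) ^ M \<le> (2 * p) ^ M"
        using p \<beta> by (intro power_mono) (auto simp: field_simps)
      also have "\<dots> = (2 * C * ln K) ^ M / K ^ M"
        by (simp add: p_def power_divide mult.assoc)
      finally have "real m * (real n * (p / \<beta>) ^ M)
          \<le> real m * ((K ^ M * K powr (- 1 / ln (ln K))) * ((2 * C * ln K) ^ M / K ^ M))"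
        using n' p \<beta> K by (intro mult_left_mono mult_mono) auto
      also have "\<dots> = real m * (K powr (- 1 / ln (ln K)) * (2 * C * ln K) powr (real m - 1))"
        using K C by (subst powM) auto
      also have "\<dots> \<le> 1 / 8" using k0' by simp
      finally have "p * (real m * (real n * (p / \<beta>) ^ M)) \<le> p * (1 / 8)"
        using p by (intro mult_left_mono) auto
      then show ?thesis by (simp add: M power_divide algebra_simps)
    qed
    moreover have "real (k * n) * ((1 - p) ^ k / \<beta> ^ (k - 1)) \<le> p / 8"
    proof -
      have "(1 - p) ^ k / \<beta> ^ (k - 1) \<le> (1 - p) ^ k / \<beta> ^ k"
        using p \<beta> by (intro divide_left_mono power_decreasing) auto
      also have "\<dots> = ((1 - p) / \<beta>) ^ k" by (simp add: power_divide)
      also have "\<dots> \<le> exp (- p / 2) ^ k"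
      proof (rule power_mono)
        \<comment> \<open>The right side is 1 - 3p/4 + p^2/8: dividing by \<open>\<beta>\<close>
          still leaves half of the decay rate \<open>p\<close>.\<close>
        have "1 - p \<le> (1 - p / 2) * \<beta>" using p by (simp add: \<beta>_def algebra_simps)
        then have "(1 - p) / \<beta> \<le> 1 - p / 2" using \<beta> by (simp add: divide_simps)
        also have "\<dots> \<le> exp (- p / 2)" using exp_ge_add_one_self[of "- p / 2"] by simp
        finally show "(1 - p) / \<beta> \<le> exp (- p / 2)" .
      qed (use p \<beta> in auto)
      also have "\<dots> = exp (- (real (m + 2) * ln K))"
        using K by (simp add: exp_of_nat_mult[symmetric] p_def C_def K_def)
      also have "\<dots> = 1 / K ^ (m + 2)"
        unfolding exp_minus exp_of_nat_mult using K by (simp add: inverse_eq_divide)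
      finally have *: "(1 - p) ^ k / \<beta> ^ (k - 1) \<le> 1 / K ^ (m + 2)" .
      have "K powr (- 1 / ln (ln K)) \<le> K powr 0" using K by (intro powr_mono) auto
      then have "K ^ M * K powr (- 1 / ln (ln K)) \<le> K ^ M * 1"
        using K by (intro mult_left_mono) auto
      then have "real n \<le> K ^ M" using n' by simp
      then have "real (k * n) * ((1 - p) ^ k / \<beta> ^ (k - 1)) \<le> (K * K ^ M) * (1 / K ^ (m + 2))"
        using * K p \<beta> by (intro mult_mono) (auto simp: K_def)
      also have "\<dots> = 1 / K\<^sup>2" using K by (simp add: M power2_eq_square)
      also have "\<dots> \<le> p / 8" using k0' by simp
      finally show ?thesis .
    qed
    ultimately have "real (m * n) * (p ^ m / \<beta> ^ (m - 1)) + real (k * n) * ((1 - p) ^ k / \<beta> ^ (k - 1)) \<le> 1 - \<beta>"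
      using p \<beta>_def by linarith
    then show ?thesis
      using m K p \<beta> by (intro not_vdw_propertyI[of m k p \<beta>]) (auto simp: K_def)
  qed
  then show ?thesis by blast
qed

theorem theorem2p5:
  fixes m :: nat
  assumes "m \<ge> 3"
  shows "\<exists>k0. \<forall>k\<ge>k0. k > 0 \<longrightarrow>
    real (vdw_number k m) > real k powr (real m - 1 - 1 / ln (ln (real k)))"
proof -
  obtain k0 where k0: "\<And>k n. k \<ge> k0 \<Longrightarrow> real n \<le> real k powr (real m - 1 - 1 / ln (ln (real k))) \<Longrightarrow>
      \<not> vdw_property k m n"
    using not_vdw_property_asymp[of m] assms by auto
  \<comment> \<open>The least element has the property because some \<open>n\<close> has it, whereas
    every \<open>n\<close> up to the bound lacks it.\<close>
  have "vdw_property k m (vdw_number k m)" for k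
    unfolding vdw_number_def using LeastI_ex[OF vdw_property_exists[of k m]] by blast
  then show ?thesis using k0 by (meson not_le)
qed

end
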